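(* Let $V$ be a separable Hilbert space, $\mathcal{I}$ a finite index set, and $(V_i)_{i\in\mathcal{I}}$ linear subspaces of $V$ with $V=\sum_{i\in\mathcal{I}}V_i$, each equipped with a quadratic norm making it a Hilbert space, $\|v_i\|_{V_i}^2=[Q_i^{-1}v_i,v_i]$, where $Q_i:V_i^*\to V_i$ is a positive symmetric linear bijection. Let $S=\sum_{i\in\mathcal{I}}e_iQ_ie_i^*:V^*\to V$, fix $v\in V$, let $\Psi_i(v):=Q_ie_i^*S^{-1}v\in V_i$ and $E(i):=\|\Psi_i(v)\|_{V_i}^2$ for $i\in\mathcal{I}$. Let $\xi\sim\mathcal{N}(0,Q)$ be the centered Gaussian field on $\mathcal{B}=\prod_{i\in\mathcal{I}}V_i$ with block-diagonal covariance operator $Q=\mathrm{diag}(Q_i)_{i\in\mathcal{I}}$, with components $\xi_i$, and let $\phi:=S^{-1}v$. Then for every $i\in\mathcal{I}$, $$E(i)=\langle\Psi_i(v),v\rangle_{S^{-1}}=\mathrm{Var}\big([\phi,\xi_i]\big)=\mathrm{Var}\big(\langle\xi_i,v\rangle_{S^{-1}}\big).$$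
   Context: $[\cdot,\cdot]$ denotes the duality product between a dual space (left) and the space (right), both for $(V^*,V)$ and for $(V_i^*,V_i)$, where $V_i^*$ is the topological dual of $(V_i,\|\cdot\|_{V_i})$. A linear bijection $Q_i:V_i^*\to V_i$ is positive symmetric if $[\phi,Q_i\phi]\ge 0$ and $[\phi,Q_i\varphi]=[\varphi,Q_i\phi]$ for all $\phi,\varphi\in V_i^*$. $e_i:V_i\to V$ is the subset inclusion, assumed continuous from $(V_i,\|\cdot\|_{V_i})$ to $V$, with adjoint $e_i^*:V^*\to V_i^*$, $[e_i^*\phi,v_i]=[\phi,e_iv_i]$. The operator $S$ is invertible, and $\langle\cdot,\cdot\rangle_{S^{-1}}$ is the inner product $\langle v,w\rangle_{S^{-1}}=[S^{-1}v,w]$ on $V$. $\mathcal{B}$ carries the norm $\|u\|_{\mathcal{B}}^2=\sum_i\|u_i\|_{V_i}^2$, and $\mathcal{B}^*=\prod_iV_i^*$ with $[\phi,u]=\sum_i[\phi_i,u_i]$ and norm $\|\phi\|_{\mathcal{B}^*}^2=\sum_i[\phi_i,Q_i\phi_i]$. A centered Gaussian field $\xi\sim\mathcal{N}(0,Q)$ on $\mathcal{B}$ is a linear isometry $\phi\mapsto[\phi,\xi]$ from $\mathcal{B}^*$ to a linear space of centered Gaussian random variables in some $L^2(\Omega,\Sigma,\mathbb{P})$, so that $[\phi,\xi]\sim\mathcal{N}(0,[\phi,Q\phi])$. Its component $\xi_i$ is the Gaussian field on $V_i$ given by $[\phi_i,\xi_i]:=[(0,\ldots,\phi_i,\ldots,0),\xi]$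 for $\phi_i\in V_i^*$. For $\phi\in V^*$, $[\phi,\xi_i]$ means $[e_i^*\phi,\xi_i]$, and $\langle\xi_i,v\rangle_{S^{-1}}$ means $[e_i^*S^{-1}v,\xi_i]$. *)

theory Defs
  imports "HOL-Probability.Probability"
begin

text \<open>
  The spaces \<open>V\<^sub>i\<close> carry different norms, so they are represented by carrier sets \<open>W\<close> in the ambient
  Hilbert space together with a norm function \<open>n\<close>, whose values off \<open>W\<close> are irrelevant.
\<close>

definition hilbert_norm_on :: "'v::real_vector set \<Rightarrow> ('v \<Rightarrow> real) \<Rightarrow> bool" where
  "hilbert_norm_on W n \<longleftrightarrow>
    (\<exists>b. (\<forall>x\<in>W. \<forall>y\<in>W. b x y = b y x)
       \<and> (\<forall>x\<in>W. \<forall>y\<in>W. \<forall>z\<in>W. b (x + y) z = b x z + b y z)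
       \<and> (\<forall>x\<in>W. \<forall>y\<in>W. \<forall>c. b (c *\<^sub>R x) y = c * b x y)
       \<and> (\<forall>x\<in>W. x \<noteq> 0 \<longrightarrow> b x x > 0)
       \<and> (\<forall>x\<in>W. n x = sqrt (b x x)))
    \<and> (\<forall>X. (\<forall>k. X k \<in> W) \<and> (\<forall>e>0. \<exists>N. \<forall>j\<ge>N. \<forall>k\<ge>N. n (X j - X k) < e)
         \<longrightarrow> (\<exists>x\<in>W. (\<lambda>k. n (X k - x)) \<longlonglongrightarrow> 0))"

text \<open>
  The topological dual of \<open>(W, n)\<close>. A functional on \<open>W\<close> is extended by \<open>0\<close> off \<open>W\<close>, so that it is
  determined by its values on \<open>W\<close> and the vector space operations are the pointwise ones.
\<close>

definition dual_on :: "'v::real_vector set \<Rightarrow> ('v \<Rightarrow> real) \<Rightarrow> ('v \<Rightarrow> real) set" where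
  "dual_on W n = {f. (\<forall>x. x \<notin> W \<longrightarrow> f x = 0)
     \<and> (\<forall>x\<in>W. \<forall>y\<in>W. f (x + y) = f x + f y)
     \<and> (\<forall>c. \<forall>x\<in>W. f (c *\<^sub>R x) = c * f x)
     \<and> (\<exists>C. \<forall>x\<in>W. \<bar>f x\<bar> \<le> C * n x)}"

definition pos_sym_bij ::
  "'v::real_vector set \<Rightarrow> ('v \<Rightarrow> real) \<Rightarrow> (('v \<Rightarrow> real) \<Rightarrow> 'v) \<Rightarrow> bool" where
  "pos_sym_bij W n Q \<longleftrightarrow>
     bij_betw Q (dual_on W n) W
   \<and> (\<forall>f\<in>dual_on W n. \<forall>g\<in>dual_on W n. Q (\<lambda>x. f x + g x) = Q f + Q g)
   \<and> (\<forall>c. \<forall>f\<in>dual_on W n. Q (\<lambda>x. c * f x) = c *\<^sub>R Q f)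
   \<and> (\<forall>f\<in>dual_on W n. f (Q f) \<ge> 0)
   \<and> (\<forall>f\<in>dual_on W n. \<forall>g\<in>dual_on W n. f (Q g) = g (Q f))"

text \<open>
  The adjoint of the inclusion of \<open>W\<close> is restriction to \<open>W\<close> (extended by \<open>0\<close> as above).
\<close>

definition incl_adj :: "'v::real_normed_vector set \<Rightarrow> ('v \<Rightarrow>\<^sub>L real) \<Rightarrow> 'v \<Rightarrow> real" where
  "incl_adj W \<phi> = (\<lambda>x. if x \<in> W then blinfun_apply \<phi> x else 0)"

definition S_op ::
  "('i::finite \<Rightarrow> 'v::real_normed_vector set) \<Rightarrow> ('i \<Rightarrow> ('v \<Rightarrow> real) \<Rightarrow> 'v) \<Rightarrow> ('v \<Rightarrow>\<^sub>L real) \<Rightarrow> 'v" where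
  "S_op V Q \<phi> = (\<Sum>i\<in>UNIV. Q i (incl_adj (V i) \<phi>))"

text \<open>
  If the \<open>V\<^sub>i\<close> are continuously included and sum to the whole space, then \<open>S\<close> is coercive, hence a
  bijection, so that \<open>inv\<close> is its two-sided inverse; bijectivity is not needed as a hypothesis.
\<close>

definition S_inv ::
  "('i::finite \<Rightarrow> 'v::real_normed_vector set) \<Rightarrow> ('i \<Rightarrow> ('v \<Rightarrow> real) \<Rightarrow> 'v) \<Rightarrow> 'v \<Rightarrow> ('v \<Rightarrow>\<^sub>L real)" where
  "S_inv V Q = inv (S_op V Q)"

definition inner_S_inv ::
  "('i::finite \<Rightarrow> 'v::real_normed_vector set) \<Rightarrow> ('i \<Rightarrow> ('v \<Rightarrow> real) \<Rightarrow> 'v) \<Rightarrow> 'v \<Rightarrow> 'v \<Rightarrow> real" where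
  "inner_S_inv V Q v w = blinfun_apply (S_inv V Q v) w"

definition Psi ::
  "('i::finite \<Rightarrow> 'v::real_normed_vector set) \<Rightarrow> ('i \<Rightarrow> ('v \<Rightarrow> real) \<Rightarrow> 'v) \<Rightarrow> 'i \<Rightarrow> 'v \<Rightarrow> 'v" where
  "Psi V Q i v = Q i (incl_adj (V i) (S_inv V Q v))"

definition energy ::
  "('i::finite \<Rightarrow> 'v::real_normed_vector set) \<Rightarrow> ('i \<Rightarrow> 'v \<Rightarrow> real) \<Rightarrow>
   ('i \<Rightarrow> ('v \<Rightarrow> real) \<Rightarrow> 'v) \<Rightarrow> 'v \<Rightarrow> 'i \<Rightarrow> real" where
  "energy V n Q v i = (n i (Psi V Q i v))\<^sup>2"

definition prod_dual ::
  "('i \<Rightarrow> 'v::real_vector set) \<Rightarrow> ('i \<Rightarrow> 'v \<Rightarrow> real) \<Rightarrow> ('i \<Rightarrow> 'v \<Rightarrow> real) set" where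
  "prod_dual V n = {\<phi>. \<forall>i. \<phi> i \<in> dual_on (V i) (n i)}"

definition prod_pairing :: "('i::finite \<Rightarrow> 'v \<Rightarrow> real) \<Rightarrow> ('i \<Rightarrow> 'v) \<Rightarrow> real" where
  "prod_pairing \<phi> u = (\<Sum>i\<in>UNIV. \<phi> i (u i))"

definition diag_op :: "('i \<Rightarrow> ('v \<Rightarrow> real) \<Rightarrow> 'v) \<Rightarrow> ('i \<Rightarrow> 'v \<Rightarrow> real) \<Rightarrow> 'i \<Rightarrow> 'v" where
  "diag_op Q \<phi> = (\<lambda>i. Q i (\<phi> i))"

text \<open>Centered Gaussian random variables include the degenerate one, which is almost surely \<open>0\<close>.\<close>

definition centered_gaussian :: "'a measure \<Rightarrow> ('a \<Rightarrow> real) \<Rightarrow> bool" where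
  "centered_gaussian M X \<longleftrightarrow>
     (\<exists>\<sigma>>0. distributed M lborel X (normal_density 0 \<sigma>))
   \<or> (X \<in> borel_measurable M \<and> (AE \<omega> in M. X \<omega> = 0))"

text \<open>
  \<open>\<xi> \<phi>\<close> is the random variable \<open>[\<phi>, \<xi>]\<close>. Elements of \<open>L\<^sup>2\<close> are given by representatives, so linearity
  holds almost surely. The last clause is the isometry, as
  \<open>\<parallel>\<phi>\<parallel>\<^sup>2 = [\<phi>, Q \<phi>]\<close> in the dual of the product space.
\<close>

definition gaussian_field ::
  "'a measure \<Rightarrow> ('i::finite \<Rightarrow> 'v::real_vector set) \<Rightarrow> ('i \<Rightarrow> 'v \<Rightarrow> real) \<Rightarrow>
   (('i \<Rightarrow> 'v \<Rightarrow> real) \<Rightarrow> 'i \<Rightarrow> 'v) \<Rightarrow> (('i \<Rightarrow> 'v \<Rightarrow> real) \<Rightarrow> 'a \<Rightarrow> real) \<Rightarrow> bool" where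
  "gaussian_field M V n Q \<xi> \<longleftrightarrow>
     (\<forall>\<phi>\<in>prod_dual V n. centered_gaussian M (\<xi> \<phi>))
   \<and> (\<forall>\<phi>\<in>prod_dual V n. \<forall>\<psi>\<in>prod_dual V n.
        AE \<omega> in M. \<xi> (\<lambda>i x. \<phi> i x + \<psi> i x) \<omega> = \<xi> \<phi> \<omega> + \<xi> \<psi> \<omega>)
   \<and> (\<forall>c. \<forall>\<phi>\<in>prod_dual V n. AE \<omega> in M. \<xi> (\<lambda>i x. c * \<phi> i x) \<omega> = c * \<xi> \<phi> \<omega>)
   \<and> (\<forall>\<phi>\<in>prod_dual V n. (\<integral>\<omega>. (\<xi> \<phi> \<omega>)\<^sup>2 \<partial>M) = prod_pairing \<phi> (Q \<phi>))"

definition field_component ::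
  "(('i \<Rightarrow> 'v \<Rightarrow> real) \<Rightarrow> 'a \<Rightarrow> real) \<Rightarrow> 'i \<Rightarrow> ('v \<Rightarrow> real) \<Rightarrow> 'a \<Rightarrow> real" where
  "field_component \<xi> i f = \<xi> (\<lambda>j. if j = i then f else (\<lambda>_. 0))"

text \<open>For \<open>\<phi>\<close> in the dual of the ambient space, \<open>[\<phi>, \<xi>\<^sub>i]\<close>.\<close>

definition pair_component ::
  "('i \<Rightarrow> 'v::real_normed_vector set) \<Rightarrow> (('i \<Rightarrow> 'v \<Rightarrow> real) \<Rightarrow> 'a \<Rightarrow> real) \<Rightarrow>
   ('v \<Rightarrow>\<^sub>L real) \<Rightarrow> 'i \<Rightarrow> 'a \<Rightarrow> real" where
  "pair_component V \<xi> \<phi> i = field_component \<xi> i (incl_adj (V i) \<phi>)"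

text \<open>The inner product of \<open>\<xi>\<^sub>i\<close> and \<open>v\<close> with respect to the inverse of \<open>S\<close>.\<close>

definition inner_component ::
  "('i::finite \<Rightarrow> 'v::real_normed_vector set) \<Rightarrow> ('i \<Rightarrow> ('v \<Rightarrow> real) \<Rightarrow> 'v) \<Rightarrow>
   (('i \<Rightarrow> 'v \<Rightarrow> real) \<Rightarrow> 'a \<Rightarrow> real) \<Rightarrow> 'i \<Rightarrow> 'v \<Rightarrow> 'a \<Rightarrow> real" where
  "inner_component V Q \<xi> i v = field_component \<xi> i (incl_adj (V i) (S_inv V Q v))"

end

(*
  Each covariance operator Q_i makes f(Q_i f) = |Q_i f|^2, so the energy E(i) and the variances are
  both the number [e_i^* phi, Q_i e_i^* phi] with phi = S^{-1} v. The remaining identity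
  <Psi_i(v), v> = [phi, Psi_i(v)] is the symmetry of S^{-1}, which needs S to be onto. For this,
  [phi, S phi] = sum_i [e_i^* phi, Q_i e_i^* phi] bounds phi pointwise, because every x is a sum of
  elements Q_i g_i; by the uniform boundedness principle S is coercive, and composing it with the
  Riesz embedding of V into its dual reduces surjectivity to the Lax-Milgram lemma.
*)

theory Submission
  imports Defs
begin

section \<open>Uniform boundedness and the Lax-Milgram lemma\<close>

text \<open>By Baire's theorem one of the closed sets \<open>G k\<close>, on which all of
  \<open>F\<close> is bounded by \<open>k\<close>, contains a ball. Differences of points of this
  ball reach every direction, so the bound passes to the operator norms.\<close>

lemma uniform_boundedness:
  fixes F :: "('a::{real_normed_vector, complete_space} \<Rightarrow>\<^sub>L 'b::real_normed_vector) set"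
  assumes "\<And>x. \<exists>C. \<forall>f\<in>F. norm (blinfun_apply f x) \<le> C"
  shows "\<exists>K. \<forall>f\<in>F. norm f \<le> K"
proof -
  define G where "G k = {x. \<forall>f\<in>F. norm (blinfun_apply f x) \<le> real k}" for k :: nat
  have "G k = (\<Inter>f\<in>F. {x. norm (blinfun_apply f x) \<le> real k})" for k
    by (auto simp: G_def)
  then have closed: "closed (G k)" for k
    by (auto intro!: closed_INT closed_Collect_le continuous_intros)
  have "\<exists>k. x \<in> G k" for x
  proof -
    obtain C where "\<forall>f\<in>F. norm (blinfun_apply f x) \<le> C"
      using assms by blast
    moreover obtain k where "C \<le> real k"
      using real_arch_simple by blast
    ultimately have "x \<in> G k"
      unfolding G_def by force
    then show ?thesis ..
  qed
  then have cover: "(\<Union>k. G k) = UNIV"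
    by auto
  have "\<exists>k. interior (G k) \<noteq> {}"
  proof (rule ccontr)
    assume "\<not> ?thesis"
    then have "euclidean interior_of \<Union>(range G) = {}"
      by (intro Baire_category_alt)
        (auto simp: closed Met_TC.completely_metrizable_space_mtopology[simplified] complete_UNIV)
    with cover show False
      by simp
  qed
  then obtain k y where "y \<in> interior (G k)"
    by blast
  then obtain r where r: "r > 0" "ball y r \<subseteq> G k"
    by (meson mem_interior)
  have "norm f \<le> 4 * real k / r" if f: "f \<in> F" for f
  proof (rule norm_blinfun_bound)
    show "0 \<le> 4 * real k / r"
      using r by simp
    fix x
    show "norm (blinfun_apply f x) \<le> 4 * real k / r * norm x"
    proof (cases "x = 0")
      case False
      \<comment> \<open>\<open>t\<close> shrinks or stretches \<open>x\<close> to length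
        \<open>r / 2\<close>, which keeps \<open>y + t *\<^sub>R x\<close> inside the open ball. The
        two bounds by \<open>k\<close> and the length \<open>r / 2\<close> produce the constant
        \<open>4 * real k / r\<close>.\<close>
      define t where "t = r / (2 * norm x)"
      have t: "t > 0" "t * norm x = r / 2"
        using False r by (auto simp: t_def)
      have "y \<in> G k" "y + t *\<^sub>R x \<in> G k"
        using r t by (auto simp: subset_iff dist_norm)
      then have "norm (blinfun_apply f y) \<le> k" "norm (blinfun_apply f (y + t *\<^sub>R x)) \<le> k"
        using f by (auto simp: G_def)
      moreover have "t *\<^sub>R blinfun_apply f x = blinfun_apply f (y + t *\<^sub>R x) - blinfun_apply f y"
        by (simp add: blinfun.add_right blinfun.scaleR_right)
      ultimately have "norm (t *\<^sub>R blinfun_apply f x) \<le> 2 * real k"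
        using norm_triangle_ineq4[of "blinfun_apply f (y + t *\<^sub>R x)" "blinfun_apply f y"] by simp
      then have "t * norm (blinfun_apply f x) \<le> 2 * real k"
        using t by simp
      then show ?thesis
        using False r by (simp add: t_def field_simps)
    qed simp
  qed
  then show ?thesis
    by blast
qed

text \<open>A solution of \<open>T x = v\<close> is a fixed point of
  \<open>x - \<rho> *\<^sub>R (T x - v)\<close>, and coercivity makes this map a contraction for a
  suitable \<open>\<rho>\<close>.\<close>

lemma coercive_surj:
  fixes T :: "'a::{real_inner, complete_space} \<Rightarrow> 'a"
  assumes T: "bounded_linear T" and c: "c > 0"
    and coercive: "\<And>x. c * (norm x)\<^sup>2 \<le> T x \<bullet> x"
  shows "surj T"
proof -
  obtain K where K: "K > 0" "\<And>x. norm (T x) \<le> norm x * K"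
    using bounded_linear.pos_bounded[OF T] by blast
  \<comment> \<open>Enlarging \<open>K\<close> to at least \<open>c\<close> keeps the radicand of
    \<open>q\<close> nonnegative.\<close>
  define K' where "K' = max K c"
  have K': "K' \<ge> c" "K' > 0" "norm (T x) \<le> K' * norm x" for x
    using K c mult_left_mono[of K K' "norm x"] by (auto simp: K'_def mult.commute intro: order_trans)
  \<comment> \<open>This value minimizes 1 - 2 \<rho> c + \<rho>^2 K'^2, which bounds the squared
    contraction factor; the minimum is \<open>q\<^sup>2\<close>.\<close>
  define \<rho> where "\<rho> = c / K'\<^sup>2"
  define q where "q = sqrt (1 - c\<^sup>2 / K'\<^sup>2)"
  have "c\<^sup>2 / K'\<^sup>2 \<le> 1" "c\<^sup>2 / K'\<^sup>2 > 0"
    using K' c by (auto simp: divide_le_eq power_mono)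
  then have q: "0 \<le> q" "q < 1" "q\<^sup>2 = 1 - c\<^sup>2 / K'\<^sup>2"
    by (auto simp: q_def)
  have \<rho>: "\<rho> \<ge> 0"
    using c by (simp add: \<rho>_def)
  have contraction: "norm (x - \<rho> *\<^sub>R T x) \<le> q * norm x" for x
  proof -
    have "(norm (x - \<rho> *\<^sub>R T x))\<^sup>2 = (norm x)\<^sup>2 - 2 * \<rho> * (T x \<bullet> x) + \<rho>\<^sup>2 * (norm (T x))\<^sup>2"
      by (simp only: power2_norm_eq_inner inner_diff inner_scaleR_left inner_scaleR_right
          inner_commute[of x "T x"]) (simp add: algebra_simps power2_eq_square)
    also have "\<dots> \<le> (norm x)\<^sup>2 - 2 * \<rho> * (c * (norm x)\<^sup>2) + \<rho>\<^sup>2 * (K' * norm x)\<^sup>2"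
      using coercive[of x] K'(3)[of x] \<rho>
      by (intro add_mono diff_mono mult_left_mono power_mono) auto
    also have "\<dots> = (1 - c\<^sup>2 / K'\<^sup>2) * (norm x)\<^sup>2"
      using K'(2) by (simp add: \<rho>_def field_simps power2_eq_square)
    also have "\<dots> = (q * norm x)\<^sup>2"
      by (simp add: power_mult_distrib q(3))
    finally show ?thesis
      using q by (auto intro: power2_le_imp_le)
  qed
  have "\<exists>x. T x = v" for v
  proof -
    have "\<exists>!x. x - \<rho> *\<^sub>R (T x - v) = x"
    proof (rule banach_fix_type[of q], use q in simp, use q in simp, intro allI)
      fix x y
      have "dist (x - \<rho> *\<^sub>R (T x - v)) (y - \<rho> *\<^sub>R (T y - v)) = norm ((x - y) - \<rho> *\<^sub>R T (x - y))"
        using T by (simp add: dist_norm linear_diff bounded_linear.linear algebra_simps)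
      then show "dist (x - \<rho> *\<^sub>R (T x - v)) (y - \<rho> *\<^sub>R (T y - v)) \<le> q * dist x y"
        using contraction[of "x - y"] by (simp add: dist_norm)
    qed
    then obtain x where "x - \<rho> *\<^sub>R (T x - v) = x"
      by blast
    moreover have "\<rho> \<noteq> 0"
      using c K' by (simp add: \<rho>_def)
    ultimately show ?thesis
      by auto
  qed
  then show ?thesis
    by (metis surj_def)
qed

section \<open>Dual spaces and positive symmetric operators\<close>

lemma dual_on_add:
  assumes "f \<in> dual_on W n" "g \<in> dual_on W n"
  shows "(\<lambda>x. f x + g x) \<in> dual_on W n"
proof -
  obtain C D where "\<forall>x\<in>W. \<bar>f x\<bar> \<le> C * n x" "\<forall>x\<in>W. \<bar>g x\<bar> \<le> D * n x"
    using assms by (auto simp: dual_on_def)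
  then have "\<forall>x\<in>W. \<bar>f x + g x\<bar> \<le> (C + D) * n x"
    by (auto simp: distrib_right intro: order_trans[OF abs_triangle_ineq add_mono])
  then have "\<exists>C. \<forall>x\<in>W. \<bar>f x + g x\<bar> \<le> C * n x" ..
  then show ?thesis
    using assms unfolding dual_on_def by (simp add: distrib_left)
qed

lemma dual_on_scale:
  assumes "f \<in> dual_on W n"
  shows "(\<lambda>x. c * f x) \<in> dual_on W n"
proof -
  obtain C where "\<forall>x\<in>W. \<bar>f x\<bar> \<le> C * n x"
    using assms by (auto simp: dual_on_def)
  then have "\<forall>x\<in>W. \<bar>c * f x\<bar> \<le> (\<bar>c\<bar> * C) * n x"
    by (auto simp: abs_mult mult.assoc intro: mult_left_mono)
  then have "\<exists>C. \<forall>x\<in>W. \<bar>c * f x\<bar> \<le> C * n x" ..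
  then show ?thesis
    using assms unfolding dual_on_def by (simp add: distrib_left mult.left_commute)
qed

lemma zero_in_dual_on: "(\<lambda>_. 0) \<in> dual_on W n"
  by (auto simp: dual_on_def intro: exI[of _ 0])

text \<open>The quadratic form of \<open>Q\<close> is nonnegative at f + g and f - g. This is
  Cauchy-Schwarz in its arithmetic mean form, which can be summed over the index set
  directly.\<close>

lemma pos_sym_bij_pairing_bound:
  assumes Q: "pos_sym_bij W n Q" and f: "f \<in> dual_on W n" and g: "g \<in> dual_on W n"
  shows "\<bar>f (Q g)\<bar> \<le> (f (Q f) + g (Q g)) / 2"
proof -
  have lin: "Q (\<lambda>x. f x + c * g x) = Q f + c *\<^sub>R Q g" for c
    using Q f g dual_on_scale[OF g, of c] by (simp add: pos_sym_bij_def)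
  have W: "Q f \<in> W" "Q g \<in> W"
    using Q f g by (auto simp: pos_sym_bij_def bij_betw_def)
  \<comment> \<open>\<open>W\<close> is a bare carrier set here, so closure under scaling is read
    off from the image of \<open>Q\<close>; \<open>f\<close> and \<open>g\<close> are additive only
    on \<open>W\<close>.\<close>
  have W': "c *\<^sub>R Q g \<in> W" for c
    using Q dual_on_scale[OF g, of c] g unfolding pos_sym_bij_def by (metis bij_betwE)
  have "0 \<le> f (Q f) + 2 * c * f (Q g) + c\<^sup>2 * g (Q g)" for c
  proof -
    have "(\<lambda>x. f x + c * g x) \<in> dual_on W n"
      by (intro dual_on_add dual_on_scale f g)
    moreover have "0 \<le> h (Q h)" if "h \<in> dual_on W n" for h
      using Q that by (simp add: pos_sym_bij_def)
    ultimately have "0 \<le> f (Q f + c *\<^sub>R Q g) + c * g (Q f + c *\<^sub>R Q g)"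
      unfolding lin[symmetric] by blast
    also have "\<dots> = f (Q f) + c * f (Q g) + c * (g (Q f) + c * g (Q g))"
      using f g W W' by (simp add: dual_on_def)
    also have "g (Q f) = f (Q g)"
      using Q f g by (simp add: pos_sym_bij_def)
    finally show ?thesis
      by (simp add: algebra_simps power2_eq_square)
  qed
  from this[of 1] this[of "-1"] show ?thesis
    by simp
qed

text \<open>The mean vanishes in the normal and in the degenerate case alike. This turns the
  isometry of a Gaussian field into a statement about variances.\<close>

lemma (in prob_space) centered_gaussian_variance:
  assumes "centered_gaussian M X"
  shows "variance X = (\<integral>\<omega>. (X \<omega>)\<^sup>2 \<partial>M)"
proof -
  have "expectation X = 0"
    using assms unfolding centered_gaussian_def
    by (auto simp: normal_distributed_expectation intro: integral_eq_zero_AE)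
  then show ?thesis
    by simp
qed

section \<open>The operator S: boundedness, symmetry, coercivity, surjectivity\<close>

locale subspace_decomposition =
  fixes V :: "'i::finite \<Rightarrow> 'v::{real_inner, complete_space} set"
    and n :: "'i \<Rightarrow> 'v \<Rightarrow> real"
    and Q :: "'i \<Rightarrow> ('v \<Rightarrow> real) \<Rightarrow> 'v"
  assumes subspace: "subspace (V i)"
    and spanning: "\<exists>u. (\<forall>i. u i \<in> V i) \<and> x = (\<Sum>i\<in>UNIV. u i)"
    and continuous_incl: "\<exists>C. \<forall>x\<in>V i. norm x \<le> C * n i x"
    and pos_sym: "pos_sym_bij (V i) (n i) (Q i)"
    and norm_eq: "x \<in> V i \<Longrightarrow> (n i x)\<^sup>2 = inv_into (dual_on (V i) (n i)) (Q i) x x"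
begin

text \<open>Continuity of the inclusion turns the bound on \<phi> in the ambient norm into one in
  \<open>n i\<close>.\<close>

lemma incl_adj_in_dual_on: "incl_adj (V i) \<phi> \<in> dual_on (V i) (n i)"
proof -
  obtain C where C: "\<forall>x\<in>V i. norm x \<le> C * n i x"
    using continuous_incl by blast
  have "\<bar>blinfun_apply \<phi> x\<bar> \<le> (norm \<phi> * C) * n i x" if "x \<in> V i" for x
  proof -
    have "\<bar>blinfun_apply \<phi> x\<bar> \<le> norm \<phi> * norm x"
      using norm_blinfun[of \<phi> x] by simp
    also have "\<dots> \<le> norm \<phi> * (C * n i x)"
      using C that by (intro mult_left_mono) auto
    finally show ?thesis
      by (simp add: mult.assoc)
  qed
  then show ?thesis
    using subspace[of i] unfolding dual_on_def incl_adj_def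
    by (auto simp: blinfun.add_right blinfun.scaleR_right subspace_add subspace_scale)
qed

lemma Q_in: "f \<in> dual_on (V i) (n i) \<Longrightarrow> Q i f \<in> V i"
  using pos_sym[of i] by (auto simp: pos_sym_bij_def bij_betw_def)

text \<open>The inverse in \<open>norm_eq\<close> cancels at \<open>Q i f\<close>, so energies
  become pairings.\<close>

lemma norm_Q: "f \<in> dual_on (V i) (n i) \<Longrightarrow> (n i (Q i f))\<^sup>2 = f (Q i f)"
  using pos_sym[of i] by (simp add: norm_eq Q_in pos_sym_bij_def bij_betw_def inv_into_f_f)

lemma incl_adj_Q:
  "f \<in> dual_on (V i) (n i) \<Longrightarrow> incl_adj (V i) \<phi> (Q i f) = blinfun_apply \<phi> (Q i f)"
  by (simp add: incl_adj_def Q_in)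

text \<open>Continuity of \<open>Q i\<close> is not part of \<open>pos_sym_bij\<close>. The bound
  comes from the squared norm of \<open>w\<close> being \<phi>(w): cancelling one factor bounds
  \<open>n i w\<close>, and the inclusion contributes the second factor \<open>C\<close>.\<close>

lemma Q_incl_adj_bounded_linear: "bounded_linear (\<lambda>\<phi>. Q i (incl_adj (V i) \<phi>))"
proof -
  obtain C0 where C0: "\<forall>x\<in>V i. norm x \<le> C0 * n i x"
    using continuous_incl by blast
  \<comment> \<open>\<open>norm_eq\<close> determines only the square of \<open>n i\<close>;
    absolute values cover both signs.\<close>
  define C where "C = \<bar>C0\<bar>"
  show ?thesis
  proof (rule bounded_linear_intro)
    fix \<phi> \<psi> :: "'v \<Rightarrow>\<^sub>L real" and c :: real
    have "incl_adj (V i) (\<phi> + \<psi>) = (\<lambda>x. incl_adj (V i) \<phi> x + incl_adj (V i) \<psi> x)"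
      and "incl_adj (V i) (c *\<^sub>R \<phi>) = (\<lambda>x. c * incl_adj (V i) \<phi> x)"
      by (auto simp: incl_adj_def blinfun.add_left blinfun.scaleR_left)
    then show "Q i (incl_adj (V i) (\<phi> + \<psi>)) = Q i (incl_adj (V i) \<phi>) + Q i (incl_adj (V i) \<psi>)"
      and "Q i (incl_adj (V i) (c *\<^sub>R \<phi>)) = c *\<^sub>R Q i (incl_adj (V i) \<phi>)"
      using pos_sym[of i] by (simp_all add: pos_sym_bij_def incl_adj_in_dual_on)
    define w where "w = Q i (incl_adj (V i) \<phi>)"
    have "w \<in> V i"
      by (simp add: w_def Q_in incl_adj_in_dual_on)
    then have "norm w \<le> C0 * n i w"
      using C0 by blast
    also have "\<dots> \<le> \<bar>C0 * n i w\<bar>"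
      by simp
    finally have w: "norm w \<le> C * \<bar>n i w\<bar>"
      by (simp add: C_def abs_mult)
    have "\<bar>n i w\<bar>\<^sup>2 = blinfun_apply \<phi> w"
      by (simp add: w_def norm_Q incl_adj_in_dual_on incl_adj_Q)
    also have "\<dots> \<le> norm \<phi> * norm w"
      using norm_blinfun[of \<phi> w] by simp
    also have "\<dots> \<le> norm \<phi> * (C * \<bar>n i w\<bar>)"
      using w by (intro mult_left_mono) auto
    finally have "\<bar>n i w\<bar> * \<bar>n i w\<bar> \<le> (norm \<phi> * C) * \<bar>n i w\<bar>"
      by (simp add: power2_eq_square mult.assoc)
    then have "\<bar>n i w\<bar> \<le> norm \<phi> * C"
      by (cases "n i w = 0") (simp_all add: C_def mult_le_cancel_right del: abs_mult_self_eq)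
    then have "C * \<bar>n i w\<bar> \<le> C * (norm \<phi> * C)"
      by (intro mult_left_mono) (auto simp: C_def)
    with w show "norm (Q i (incl_adj (V i) \<phi>)) \<le> norm \<phi> * (C * C)"
      unfolding w_def by (simp add: mult.left_commute mult.commute)
  qed
qed

lemma S_op_bounded_linear: "bounded_linear (S_op V Q)"
  unfolding S_op_def[abs_def] by (intro bounded_linear_sum Q_incl_adj_bounded_linear)

text \<open>Splits the ambient pairing into pairings on the single subspaces, where symmetry and
  positivity of each \<open>Q i\<close> apply.\<close>

lemma apply_S_op:
  "blinfun_apply \<phi> (S_op V Q \<psi>)
    = (\<Sum>i\<in>UNIV. incl_adj (V i) \<phi> (Q i (incl_adj (V i) \<psi>)))"
  by (simp add: S_op_def blinfun.sum_right incl_adj_Q incl_adj_in_dual_on)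

lemma S_op_sym: "blinfun_apply \<phi> (S_op V Q \<psi>) = blinfun_apply \<psi> (S_op V Q \<phi>)"
  using pos_sym unfolding apply_S_op pos_sym_bij_def
  by (intro sum.cong refl) (metis incl_adj_in_dual_on)

lemma S_op_energy_ball_bounded:
  "\<exists>K. \<forall>\<phi>. blinfun_apply \<phi> (S_op V Q \<phi>) \<le> 1 \<longrightarrow> norm \<phi> \<le> K"
proof -
  have "\<exists>C. \<forall>\<phi>\<in>{\<phi>. blinfun_apply \<phi> (S_op V Q \<phi>) \<le> 1}. norm (blinfun_apply \<phi> x) \<le> C" for x
  proof -
    obtain u where u: "\<And>i. u i \<in> V i" "x = (\<Sum>i\<in>UNIV. u i)"
      using spanning by blast
    have "\<exists>g\<in>dual_on (V i) (n i). u i = Q i g" for i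
      using pos_sym[of i] u(1)[of i] unfolding pos_sym_bij_def bij_betw_def by blast
    then obtain g where g: "\<And>i. g i \<in> dual_on (V i) (n i)" "\<And>i. u i = Q i (g i)"
      by metis
    \<comment> \<open>\<open>g\<close> depends on \<open>x\<close> alone, so the bound is uniform
      over the energy ball.\<close>
    have "norm (blinfun_apply \<phi> x) \<le> (1 + (\<Sum>i\<in>UNIV. g i (Q i (g i)))) / 2"
      if "blinfun_apply \<phi> (S_op V Q \<phi>) \<le> 1" for \<phi>
    proof -
      let ?f = "\<lambda>i. incl_adj (V i) \<phi>"
      have "norm (blinfun_apply \<phi> x) = \<bar>\<Sum>i\<in>UNIV. ?f i (Q i (g i))\<bar>"
        using g(1) by (simp add: u(2) g(2) blinfun.sum_right incl_adj_Q)
      also have "\<dots> \<le> (\<Sum>i\<in>UNIV. \<bar>?f i (Q i (g i))\<bar>)"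
        by (rule sum_abs)
      also have "\<dots> \<le> (\<Sum>i\<in>UNIV. (?f i (Q i (?f i)) + g i (Q i (g i))) / 2)"
        by (intro sum_mono pos_sym_bij_pairing_bound[OF pos_sym incl_adj_in_dual_on g(1)])
      also have "\<dots> = (blinfun_apply \<phi> (S_op V Q \<phi>) + (\<Sum>i\<in>UNIV. g i (Q i (g i)))) / 2"
        by (simp add: apply_S_op sum.distrib flip: sum_divide_distrib)
      finally show ?thesis
        using that by simp
    qed
    then show ?thesis
      by blast
  qed
  from uniform_boundedness[OF this] show ?thesis
    by simp
qed

text \<open>Both sides are quadratic in \<phi>, so it suffices to compare them on one sphere outside
  the ball containing all \<phi> of energy at most 1.\<close>

lemma S_op_coercive: "\<exists>c>0. \<forall>\<phi>. c * (norm \<phi>)\<^sup>2 \<le> blinfun_apply \<phi> (S_op V Q \<phi>)"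
proof -
  obtain K0 where K0: "\<And>\<phi>. blinfun_apply \<phi> (S_op V Q \<phi>) \<le> 1 \<Longrightarrow> norm \<phi> \<le> K0"
    using S_op_energy_ball_bounded by blast
  define K where "K = max K0 1"
  have K: "K > 0" "\<And>\<phi>. blinfun_apply \<phi> (S_op V Q \<phi>) \<le> 1 \<Longrightarrow> norm \<phi> \<le> K"
    using K0 by (force simp: K_def)+
  have "(1 / (2 * K)\<^sup>2) * (norm \<phi>)\<^sup>2 \<le> blinfun_apply \<phi> (S_op V Q \<phi>)" for \<phi>
  proof (cases "\<phi> = 0")
    case True
    then show ?thesis
      by simp
  next
    case False
    \<comment> \<open>Rescales \<phi> to norm \<open>2 * K\<close>, strictly beyond
      \<open>K\<close>, where the energy must exceed 1.\<close>
    define t where "t = 2 * K / norm \<phi>"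
    have t: "t > 0"
      using False K by (simp add: t_def)
    have "\<not> norm (t *\<^sub>R \<phi>) \<le> K"
      using False K by (simp add: t_def)
    then have "1 < blinfun_apply (t *\<^sub>R \<phi>) (S_op V Q (t *\<^sub>R \<phi>))"
      using K(2)[of "t *\<^sub>R \<phi>"] by force
    also have "\<dots> = t\<^sup>2 * blinfun_apply \<phi> (S_op V Q \<phi>)"
      by (simp add: linear_scale[OF bounded_linear.linear[OF S_op_bounded_linear]]
          blinfun.scaleR_left blinfun.scaleR_right power2_eq_square)
    finally show ?thesis
      using False K by (simp add: t_def field_simps)
  qed
  moreover have "1 / (2 * K)\<^sup>2 > 0"
    using K by simp
  ultimately show ?thesis
    by blast
qed

lemma S_op_surj: "surj (S_op V Q)"
proof -
  obtain c where c: "c > 0" "\<And>\<phi>. c * (norm \<phi>)\<^sup>2 \<le> blinfun_apply \<phi> (S_op V Q \<phi>)"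
    using S_op_coercive by blast
  \<comment> \<open>Testing the functional at \<open>x\<close> itself shows that the Riesz embedding
    does not shrink norms, so coercivity of S passes to the composite.\<close>
  have norm_le: "norm x \<le> norm (blinfun_inner_right x)" for x :: 'v
  proof (cases "x = 0")
    case False
    have "norm x * norm x \<le> norm (blinfun_inner_right x) * norm x"
      using norm_blinfun[of "blinfun_inner_right x" x]
      by (simp add: power2_norm_eq_inner flip: power2_eq_square)
    with False show ?thesis
      by simp
  qed simp
  have "surj (\<lambda>x. S_op V Q (blinfun_inner_right x))"
  proof (rule coercive_surj)
    show "bounded_linear (\<lambda>x. S_op V Q (blinfun_inner_right x))"
      by (rule bounded_linear_compose[OF S_op_bounded_linear bounded_linear_blinfun_inner_right])
    show "c > 0"
      by (rule c)
    show "c * (norm x)\<^sup>2 \<le> S_op V Q (blinfun_inner_right x) \<bullet> x" for x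
    proof -
      have "c * (norm x)\<^sup>2 \<le> c * (norm (blinfun_inner_right x))\<^sup>2"
        using c(1) norm_le[of x] by (intro mult_left_mono power_mono) auto
      also have "\<dots> \<le> S_op V Q (blinfun_inner_right x) \<bullet> x"
        using c(2)[of "blinfun_inner_right x"] by (simp add: inner_commute)
      finally show ?thesis .
    qed
  qed
  then show ?thesis
    unfolding surj_def by blast
qed

text \<open>Surjectivity makes \<open>S_inv\<close> a right inverse of \<open>S_op\<close>, so
  \<open>S_op_sym\<close> can be read at preimages of \<open>v\<close> and \<open>w\<close>.\<close>

lemma inner_S_inv_sym: "inner_S_inv V Q v w = inner_S_inv V Q w v"
proof -
  have S: "S_op V Q (S_inv V Q x) = x" for x
    by (simp add: S_inv_def surj_f_inv_f[OF S_op_surj])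
  show ?thesis
    using S_op_sym[of "S_inv V Q v" "S_inv V Q w"] by (simp add: inner_S_inv_def S)
qed

section \<open>Variances of the field components and the energy identity\<close>

text \<open>The component evaluates the field at a functional concentrated at index
  \<open>i\<close>, where a block-diagonal covariance leaves only the \<open>i\<close>-th
  term.\<close>

lemma variance_pair_component:
  assumes "prob_space M" and field: "gaussian_field M V n (diag_op Q) \<xi>"
  shows "prob_space.variance M (pair_component V \<xi> \<phi> i)
    = incl_adj (V i) \<phi> (Q i (incl_adj (V i) \<phi>))"
proof -
  interpret prob_space M by fact
  define \<psi> where "\<psi> = (\<lambda>j. if j = i then incl_adj (V i) \<phi> else (\<lambda>_. 0))"
  have X: "pair_component V \<xi> \<phi> i = \<xi> \<psi>"
    by (simp add: pair_component_def field_component_def \<psi>_def)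
  have "\<psi> \<in> prod_dual V n"
    by (auto simp: \<psi>_def prod_dual_def incl_adj_in_dual_on zero_in_dual_on)
  then have "centered_gaussian M (\<xi> \<psi>)"
    and "(\<integral>\<omega>. (\<xi> \<psi> \<omega>)\<^sup>2 \<partial>M) = prod_pairing \<psi> (diag_op Q \<psi>)"
    using field by (auto simp: gaussian_field_def)
  \<comment> \<open>At other indices the zero functional is applied, so the value of
    \<open>Q j\<close> there is irrelevant.\<close>
  moreover have "prod_pairing \<psi> (diag_op Q \<psi>)
      = (\<Sum>j\<in>UNIV. if j = i then incl_adj (V i) \<phi> (Q i (incl_adj (V i) \<phi>)) else 0)"
    unfolding prod_pairing_def diag_op_def by (intro sum.cong) (auto simp: \<psi>_def)
  ultimately show ?thesis
    using centered_gaussian_variance[of "\<xi> \<psi>"] by (simp add: X)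
qed

end

theorem proposition4p1:
  fixes V :: "'i::finite \<Rightarrow> 'v::{real_inner, complete_space, second_countable_topology} set"
    and n :: "'i \<Rightarrow> 'v \<Rightarrow> real"
    and Q :: "'i \<Rightarrow> ('v \<Rightarrow> real) \<Rightarrow> 'v"
    and M :: "'a measure"
    and \<xi> :: "('i \<Rightarrow> 'v \<Rightarrow> real) \<Rightarrow> 'a \<Rightarrow> real"
    and v :: 'v and \<phi> :: "'v \<Rightarrow>\<^sub>L real"
  assumes "\<And>i. subspace (V i)"
    and "\<And>x. \<exists>u. (\<forall>i. u i \<in> V i) \<and> x = (\<Sum>i\<in>UNIV. u i)"
    and "\<And>i. hilbert_norm_on (V i) (n i)"
    and "\<And>i. \<exists>C. \<forall>x\<in>V i. norm x \<le> C * n i x"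
    and "\<And>i. pos_sym_bij (V i) (n i) (Q i)"
    and "\<And>i x. x \<in> V i \<Longrightarrow> (n i x)\<^sup>2 = inv_into (dual_on (V i) (n i)) (Q i) x x"
    and "prob_space M"
    and "gaussian_field M V n (diag_op Q) \<xi>"
    and "\<phi> = S_inv V Q v"
  shows "\<forall>i. energy V n Q v i = inner_S_inv V Q (Psi V Q i v) v
    \<and> inner_S_inv V Q (Psi V Q i v) v = prob_space.variance M (pair_component V \<xi> \<phi> i)
    \<and> prob_space.variance M (pair_component V \<xi> \<phi> i)
        = prob_space.variance M (inner_component V Q \<xi> i v)"
proof
  fix i
  interpret subspace_decomposition V n Q
    by unfold_locales (use assms in blast)+
  let ?f = "incl_adj (V i) \<phi>"
  have f: "?f \<in> dual_on (V i) (n i)"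
    by (rule incl_adj_in_dual_on)
  have "energy V n Q v i = ?f (Q i ?f)"
    using norm_Q[OF f] by (simp add: energy_def Psi_def assms(9))
  \<comment> \<open>Symmetry moves the inverse of S from \<open>Psi\<close> to \<open>v\<close>. As
    \<open>Psi\<close> lies in \<open>V i\<close>, \<phi> and its restriction agree there.\<close>
  moreover have "inner_S_inv V Q (Psi V Q i v) v = ?f (Q i ?f)"
    using incl_adj_Q[OF f, of \<phi>]
    by (subst inner_S_inv_sym) (simp add: inner_S_inv_def Psi_def assms(9))
  moreover have "prob_space.variance M (pair_component V \<xi> \<phi> i) = ?f (Q i ?f)"
    by (rule variance_pair_component[OF assms(7,8)])
  \<comment> \<open>The two random variables are equal as functions, not only almost surely.\<close>
  moreover have "inner_component V Q \<xi> i v = pair_component V \<xi> \<phi> i"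
    by (simp add: inner_component_def pair_component_def assms(9))
  ultimately show "energy V n Q v i = inner_S_inv V Q (Psi V Q i v) v
    \<and> inner_S_inv V Q (Psi V Q i v) v = prob_space.variance M (pair_component V \<xi> \<phi> i)
    \<and> prob_space.variance M (pair_component V \<xi> \<phi> i)
        = prob_space.variance M (inner_component V Q \<xi> i v)"
    by simp
qed

end
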